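(* Let $n \geq 1$, let $E$ be a measurable space and let $\mathcal{T}$ be a (non-empty) set of measurable functions from $E$ to $[-1,1]$. Let $a<0<b$ be two real numbers and let $w\in[a,b]^n$ be such that $\sum_{i=1}^n w_i=0$. For any $x=(x_i)_{1\le i\le n}\in E^n$ and any permutation $\sigma\in\mathfrak{S}_n$, let $$g_x(\sigma)=\sup_{t\in\mathcal{T}}\left\{\sum_{i=1}^n w_{\sigma(i)}t(x_i)\right\}.$$ Let $\sigma\in\mathfrak{S}_n$ be a uniform random permutation. Then for any $x\in E^n$ and any $u>0$, with probability at least $1-e^{-u}$, $$g_x(\sigma)-\mathbb{E}[g_x(\sigma)]\le c\,\min\left\{(b-a)\sqrt{v_+(x)},\ \|w\|_2\right\}\sqrt{u},$$ where $c$ is a numerical constant ($c=9$ holds) and $$v_+(x)=\sup_{t\in\mathcal{T}}\left\{\sum_{i=1}^n\left(t(x_i)-\frac1n\sum_{j=1}^n t(x_j)\right)^2\right\}.$$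
   Context: $\mathfrak{S}_n$ is the symmetric group on $\{1,\dots,n\}$ and $\|w\|_2$ is the Euclidean norm of $w$. *)

theory Defs
  imports "HOL-Probability.Probability" "HOL-Combinatorics.Permutations"
begin

definition uniform_perm :: "nat \<Rightarrow> (nat \<Rightarrow> nat) pmf" where
  "uniform_perm n = pmf_of_set {\<sigma>. \<sigma> permutes {1..n}}"

text \<open>
  Vectors indexed by \<open>{1..n}\<close> are functions on \<^typ>\<open>nat\<close>; values outside that range are never used.
  The suprema below are conditionally complete suprema of reals. They are genuine suprema when
  \<open>T\<close> is non-empty and its members take values in \<open>{-1..1}\<close> at the points \<open>x i\<close>.
\<close>

definition g_sup ::
    "nat \<Rightarrow> ('a \<Rightarrow> real) set \<Rightarrow> (nat \<Rightarrow> real) \<Rightarrow> (nat \<Rightarrow> 'a) \<Rightarrow> (nat \<Rightarrow> nat) \<Rightarrow> real" where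
  "g_sup n T w x \<sigma> = (SUP t\<in>T. \<Sum>i=1..n. w (\<sigma> i) * t (x i))"

definition v_plus :: "nat \<Rightarrow> ('a \<Rightarrow> real) set \<Rightarrow> (nat \<Rightarrow> 'a) \<Rightarrow> real" where
  "v_plus n T x = (SUP t\<in>T. \<Sum>i=1..n. (t (x i) - (1 / real n) * (\<Sum>j=1..n. t (x j)))\<^sup>2)"

end

theory Submission
  imports Defs
begin

hide_const (open) Finite_Cartesian_Product.transpose

text \<open>
  The uniform measure on permutations satisfies the modified logarithmic Sobolev inequality
  \<open>Ent F \<le> 1/(2n) \<Sum>\<^sub>i\<^sub>j E (F - F\<^sup>i\<^sup>j) (ln F - ln F\<^sup>i\<^sup>j)\<close>, where
  \<open>F\<^sup>i\<^sup>j \<sigma> = F (\<sigma> \<circ> (i j))\<close>; it follows by induction on \<open>n\<close> from the chain rule of entropy.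
  For \<open>F = exp (s g)\<close> and by the symmetry \<open>\<sigma> \<leftrightarrow> \<sigma> \<circ> (i j)\<close>, the right-hand side only involves the
  positive parts \<open>(g - g\<^sup>i\<^sup>j)\<^sub>+\<close>. If \<open>t\<close> is nearly optimal for \<open>g \<sigma>\<close>, these are bounded by
  \<open>(w (\<sigma> i) - w (\<sigma> j)) (t (x i) - t (x j))\<close>; estimating either the first factor by \<open>b - a\<close> or
  the second by \<open>2\<close> gives \<open>\<Sum>\<^sub>i\<^sub>j (g - g\<^sup>i\<^sup>j)\<^sub>+\<^sup>2 \<le> 8 n K\<^sup>2\<close> with \<open>K\<close> the minimum in the statement.
  Herbst's argument then yields \<open>E exp (s (g - E g)) \<le> exp (8 K\<^sup>2 s\<^sup>2)\<close>, and Chernoff's bound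
  the claim (even with \<open>\<surd>32\<close> in place of \<open>9\<close>).
\<close>

section \<open>Entropy on the symmetric group\<close>

text \<open>For positive arguments this is \<open>x * ln (x / y) + y * ln (y / x)\<close>, the
  symmetrised relative entropy density.\<close>

definition dlog :: "real \<Rightarrow> real \<Rightarrow> real" where
  "dlog x y = (x - y) * (ln x - ln y)"

lemma dlog_self [simp]: "dlog x x = 0"
  by (simp add: dlog_def)

text \<open>Convexity of \<open>x * ln (x / y)\<close>, linearised at the common ratio
  \<open>X / Y\<close> by \<open>ln z \<le> z - 1\<close>; the corrections
  \<open>f s - g s * (X / Y)\<close> sum to zero.\<close>

lemma log_sum_ineq:
  fixes f g :: "'b \<Rightarrow> real"
  assumes S: "finite S" "S \<noteq> {}" and f: "\<And>s. s \<in> S \<Longrightarrow> f s > 0" and g: "\<And>s. s \<in> S \<Longrightarrow> g s > 0"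
  shows "sum f S * (ln (sum f S) - ln (sum g S)) \<le> (\<Sum>s\<in>S. f s * (ln (f s) - ln (g s)))"
proof -
  define X Y where "X = sum f S" and "Y = sum g S"
  have X: "X > 0" and Y: "Y > 0"
    unfolding X_def Y_def using S f g by (auto intro!: sum_pos)
  have tangent: "f s * (ln X - ln Y) + f s - g s * (X / Y) \<le> f s * (ln (f s) - ln (g s))"
    if s: "s \<in> S" for s
  proof -
    have pos: "f s > 0" "g s > 0" using f g s by auto
    have "ln (g s * X / (f s * Y)) \<le> g s * X / (f s * Y) - 1"
      using pos X Y by (intro ln_le_minus_one) auto
    also have "ln (g s * X / (f s * Y)) = ln (g s) + ln X - ln (f s) - ln Y"
      using pos X Y by (simp add: ln_div ln_mult)
    finally have "f s * (ln (g s) + ln X - ln (f s) - ln Y) \<le> f s * (g s * X / (f s * Y) - 1)"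
      using pos by (intro mult_left_mono) auto
    also have "\<dots> = g s * (X / Y) - f s"
      using pos Y by (simp add: field_simps)
    finally show ?thesis by (simp add: algebra_simps)
  qed
  have "(\<Sum>s\<in>S. f s * (ln X - ln Y) + f s - g s * (X / Y)) = X * (ln X - ln Y) + X - Y * (X / Y)"
    by (simp only: sum.distrib sum_subtractf sum_distrib_right[symmetric] X_def Y_def)
  also have "\<dots> = X * (ln X - ln Y)" using Y by simp
  finally have "X * (ln X - ln Y) = (\<Sum>s\<in>S. f s * (ln X - ln Y) + f s - g s * (X / Y))" ..
  also have "\<dots> \<le> (\<Sum>s\<in>S. f s * (ln (f s) - ln (g s)))"
    by (intro sum_mono tangent)
  finally show ?thesis by (simp add: X_def Y_def)
qed

text \<open>The log-sum inequality in both directions. It will reduce the comparison of two coset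
  sums to a comparison of matched permutations.\<close>

lemma dlog_sum_le:
  fixes f g :: "'b \<Rightarrow> real"
  assumes "finite S" "S \<noteq> {}" "\<And>s. s \<in> S \<Longrightarrow> f s > 0" "\<And>s. s \<in> S \<Longrightarrow> g s > 0"
  shows "dlog (sum f S) (sum g S) \<le> (\<Sum>s\<in>S. dlog (f s) (g s))"
proof -
  have "dlog (sum f S) (sum g S) = sum f S * (ln (sum f S) - ln (sum g S))
      + sum g S * (ln (sum g S) - ln (sum f S))"
    by (simp add: dlog_def algebra_simps)
  also have "\<dots> \<le> (\<Sum>s\<in>S. f s * (ln (f s) - ln (g s))) + (\<Sum>s\<in>S. g s * (ln (g s) - ln (f s)))"
    by (intro add_mono log_sum_ineq assms)
  also have "\<dots> = (\<Sum>s\<in>S. dlog (f s) (g s))"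
    by (simp add: dlog_def algebra_simps flip: sum.distrib)
  finally show ?thesis .
qed

text \<open>Entropy with respect to the counting measure, not the uniform probability.\<close>

definition ent :: "('b \<Rightarrow> real) \<Rightarrow> 'b set \<Rightarrow> real" where
  "ent F S = (\<Sum>s\<in>S. F s * ln (F s)) - sum F S * ln (sum F S / card S)"

text \<open>Jensen replaces the logarithm of the mean by the mean of the logarithms; what remains is
  a multiple of the covariance of \<open>F\<close> and \<open>ln F\<close>, and symmetrising over
  pairs gives \<open>dlog\<close>.\<close>

lemma ent_le_dlog:
  assumes S: "finite S" "S \<noteq> {}" and pos: "\<And>s. s \<in> S \<Longrightarrow> F s > 0"
  shows "ent F S \<le> (\<Sum>l\<in>S. \<Sum>m\<in>S. dlog (F l) (F m)) / (2 * card S)"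
proof -
  let ?n = "real (card S)" and ?X = "sum F S" and ?L = "\<Sum>s\<in>S. ln (F s)"
  have n: "?n > 0" using S by (simp add: card_gt_0_iff)
  have X: "?X > 0" using S pos by (auto intro!: sum_pos)
  have eq: "(\<Sum>s\<in>S. 1 * (ln 1 - ln (F s))) = - ?L"
    by (simp add: sum_negf)
  \<comment> \<open>The log-sum inequality against the constant 1 is Jensen's inequality for
    \<open>ln\<close>.\<close>
  have "?n * (ln ?n - ln ?X) \<le> - ?L"
    using log_sum_ineq[OF S, of "\<lambda>_. 1" F] pos eq by simp
  hence "?L / ?n \<le> ln (?X / ?n)"
    using n X by (simp add: ln_div field_simps)
  hence "?X * (?L / ?n) \<le> ?X * ln (?X / ?n)"
    using X by (intro mult_left_mono) auto
  hence "ent F S \<le> (\<Sum>s\<in>S. F s * ln (F s)) - ?X * (?L / ?n)"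
    by (simp add: ent_def)
  also have "\<dots> = (2 * ?n * (\<Sum>s\<in>S. F s * ln (F s)) - 2 * (?X * ?L)) / (2 * ?n)"
    using n by (simp add: field_simps)
  also have "2 * ?n * (\<Sum>s\<in>S. F s * ln (F s)) - 2 * (?X * ?L) = (\<Sum>l\<in>S. \<Sum>m\<in>S. dlog (F l) (F m))"
    by (simp add: dlog_def left_diff_distrib right_diff_distrib sum.distrib sum_subtractf mult.commute
        flip: sum_distrib_left sum_distrib_right)
  finally show ?thesis by simp
qed

section \<open>Decomposition by the value at one point\<close>

text \<open>Chain rule for the value at \<open>k\<close>: since \<open>q\<close> fixes
  \<open>k\<close>, the \<open>transpose k l \<circ> q\<close> are the permutations sending
  \<open>k\<close> to \<open>l\<close>, and \<open>G l\<close> is the mass of this fibre.\<close>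

lemma ent_permutes_insert:
  assumes B: "finite B" "k \<notin> B" and pos: "\<And>p. F p > 0"
  defines "A \<equiv> insert k B"
  defines "G \<equiv> (\<lambda>l. \<Sum>q | q permutes B. F (transpose k l \<circ> q))"
  shows "ent F {p. p permutes A} =
    (\<Sum>l\<in>A. ent (\<lambda>q. F (transpose k l \<circ> q)) {q. q permutes B}) + ent G A"
proof -
  let ?SA = "{p. p permutes A}" and ?SB = "{p. p permutes B}"
  have A: "finite A" "card A = Suc (card B)" "A \<noteq> {}" using B by (auto simp: A_def)
  have split: "(\<Sum>p\<in>?SA. h p) = (\<Sum>l\<in>A. \<Sum>q\<in>?SB. h (transpose k l \<circ> q))" for h :: "_ \<Rightarrow> real"
    unfolding A_def by (rule sum_over_permutations_insert[OF B])
  have G: "G l > 0" for l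
    unfolding G_def using B by (intro sum_pos pos) (auto simp: finite_permutations intro: permutes_id)
  have cB: "card ?SB = fact (card B)" and cA: "card ?SA = fact (card A)"
    using B A by (intro card_permutations refl; simp)+
  have SG: "sum G A > 0" using A by (intro sum_pos G) auto
  have Gl: "(\<Sum>q\<in>?SB. F (transpose k l \<circ> q)) = G l" for l
    by (simp add: G_def)
  \<comment> \<open>Fibres are normalised by \<open>fact (card B)\<close> and the whole by
    \<open>fact (card A)\<close>; the quotient \<open>card A\<close> is the normalisation of
    \<open>ent G A\<close>, so the factorials cancel.\<close>
  have e1: "(\<Sum>l\<in>A. G l * ln (G l / fact (card B))) = (\<Sum>l\<in>A. G l * ln (G l)) - sum G A * ln (fact (card B))"
    by (simp add: ln_div G less_imp_neq[OF G, symmetric] algebra_simps sum_subtractf flip: sum_distrib_left sum_distrib_right)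
  have e2: "ln (sum G A / fact (card A)) = ln (sum G A / card A) - ln (fact (card B))"
    using SG A by (simp add: ln_div ln_mult)
  show ?thesis
    by (simp add: ent_def split cB cA sum_subtractf Gl e1 e2 right_diff_distrib)
qed

text \<open>Left multiplication by \<open>transpose l m\<close> carries the fibre over
  \<open>l\<close> to the fibre over \<open>m\<close>; the permutation \<open>r\<close> fixes
  \<open>k\<close> and only reparametrises the latter.\<close>

lemma sum_permutes_coset:
  fixes F :: "_ \<Rightarrow> real"
  assumes "l \<in> insert k B" "m \<in> insert k B" "k \<notin> B"
  shows "(\<Sum>q | q permutes B. F (transpose l m \<circ> (transpose k l \<circ> q)))
       = (\<Sum>q | q permutes B. F (transpose k m \<circ> q))"
proof -
  define r where "r = transpose k m \<circ> (transpose l m \<circ> transpose k l)"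
  have "r permutes insert k B"
    unfolding r_def using assms by (intro permutes_compose permutes_swap_id) auto
  moreover have "r k = k"
    using assms by (auto simp: r_def transpose_def)
  ultimately have r: "r permutes B"
    by (intro permutes_superset[of r "insert k B" B]) auto
  have eq: "transpose l m \<circ> (transpose k l \<circ> q) = transpose k m \<circ> (r \<circ> q)" for q
    by (auto simp: r_def fun_eq_iff)
  show ?thesis
    unfolding eq by (rule setum_permutations_compose_left[OF r, symmetric])
qed

text \<open>Conjugation turns the swaps of values, which relate the fibres, into the swaps of
  positions wanted in the final inequality.\<close>

lemma transpose_image_comp:
  assumes "p permutes A"
  shows "transpose (p k) (p j) \<circ> p = p \<circ> transpose k j"
  using permutes_inverses[OF assms] by (simp add: transpose_comp_eq permutes_bij[OF assms])

text \<open>The fibres over \<open>l\<close> and \<open>m\<close> are matched by swapping the values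
  \<open>l\<close> and \<open>m\<close>, so \<open>dlog_sum_le\<close> applies pair by pair; the
  fibres over all \<open>l\<close> together exhaust the permutations of \<open>A\<close>.\<close>

lemma sum_dlog_cosets_le:
  assumes B: "finite B" "k \<notin> B" and pos: "\<And>p. F p > 0"
  defines "A \<equiv> insert k B"
  defines "G \<equiv> (\<lambda>l. \<Sum>q | q permutes B. F (transpose k l \<circ> q))"
  shows "(\<Sum>l\<in>A. \<Sum>m\<in>A. dlog (G l) (G m))
       \<le> (\<Sum>j\<in>A. \<Sum>p | p permutes A. dlog (F p) (F (p \<circ> transpose k j)))"
proof -
  let ?SA = "{p. p permutes A}" and ?SB = "{p. p permutes B}"
  have le: "dlog (G l) (G m)
      \<le> (\<Sum>q\<in>?SB. dlog (F (transpose k l \<circ> q)) (F (transpose l m \<circ> (transpose k l \<circ> q))))"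
    if "l \<in> A" "m \<in> A" for l m
  proof -
    have "G m = (\<Sum>q\<in>?SB. F (transpose l m \<circ> (transpose k l \<circ> q)))"
      unfolding G_def using that B by (subst sum_permutes_coset) (auto simp: A_def)
    moreover have "finite ?SB" "?SB \<noteq> {}"
      using B by (auto simp: finite_permutations intro: permutes_id)
    ultimately show ?thesis
      unfolding G_def using dlog_sum_le[of ?SB] pos by simp
  qed
  have "(\<Sum>l\<in>A. \<Sum>m\<in>A. dlog (G l) (G m)) \<le>
      (\<Sum>l\<in>A. \<Sum>m\<in>A. \<Sum>q\<in>?SB. dlog (F (transpose k l \<circ> q)) (F (transpose l m \<circ> (transpose k l \<circ> q))))"
    by (intro sum_mono le)
  also have "\<dots> = (\<Sum>l\<in>A. \<Sum>q\<in>?SB. \<Sum>m\<in>A.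
      dlog (F (transpose k l \<circ> q)) (F (transpose l m \<circ> (transpose k l \<circ> q))))"
    by (rule sum.cong[OF refl]) (rule sum.swap)
  \<comment> \<open>Writing \<open>l\<close> as the value at \<open>k\<close> makes the summand a
    function of the composite alone, so that \<open>l\<close> and \<open>q\<close> merge into one
    \<open>p\<close>.\<close>
  also have "\<dots> = (\<Sum>l\<in>A. \<Sum>q\<in>?SB. \<Sum>m\<in>A. dlog (F (transpose k l \<circ> q))
      (F (transpose ((transpose k l \<circ> q) k) m \<circ> (transpose k l \<circ> q))))"
    by (auto intro!: sum.cong simp: permutes_not_in[OF _ B(2)])
  also have "\<dots> = (\<Sum>p\<in>?SA. \<Sum>m\<in>A. dlog (F p) (F (transpose (p k) m \<circ> p)))"
    unfolding A_def by (rule sum_over_permutations_insert[OF B, symmetric])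
  also have "\<dots> = (\<Sum>p\<in>?SA. \<Sum>j\<in>A. dlog (F p) (F (p \<circ> transpose k j)))"
  proof (rule sum.cong[OF refl])
    fix p assume "p \<in> ?SA"
    hence p: "p permutes A" by simp
    show "(\<Sum>m\<in>A. dlog (F p) (F (transpose (p k) m \<circ> p))) = (\<Sum>j\<in>A. dlog (F p) (F (p \<circ> transpose k j)))"
      by (subst sum.reindex_bij_betw[OF permutes_imp_bij[OF p], symmetric])
         (simp add: transpose_image_comp[OF p])
  qed
  also have "\<dots> = (\<Sum>j\<in>A. \<Sum>p\<in>?SA. dlog (F p) (F (p \<circ> transpose k j)))"
    by (rule sum.swap)
  finally show ?thesis .
qed

text \<open>The chain rule is applied to the value at \<open>k\<close> and then averaged over \<open>k\<close>; without the
  average the transpositions would not all receive the same weight.\<close>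

lemma ent_permutes_le:
  assumes "finite A" "\<And>p. F p > 0"
  shows "ent F {p. p permutes A} \<le>
    (\<Sum>i\<in>A. \<Sum>j\<in>A. \<Sum>p | p permutes A. dlog (F p) (F (p \<circ> transpose i j))) / (2 * card A)"
  using assms
proof (induction "card A" arbitrary: A F)
  case 0
  thus ?case by (simp add: ent_def)
next
  case (Suc N)
  note A = \<open>finite A\<close> and pos = \<open>\<And>p. F p > 0\<close>
  define n where "n = real (card A)"
  have n: "n \<ge> 1" "n = real N + 1" using Suc(2) by (auto simp: n_def)
  define D where "D = (\<lambda>i j. \<Sum>p | p permutes A. dlog (F p) (F (p \<circ> transpose i j)))"
  have D_self: "D i i = 0" for i by (simp add: D_def)
  define DD where "DD = (\<Sum>i\<in>A. \<Sum>j\<in>A. D i j)"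
  have dlog_nonneg: "dlog (F p) (F q) \<ge> 0" for p q
    using pos[of p] pos[of q] unfolding dlog_def
    by (cases "F p \<le> F q") (auto intro: mult_nonneg_nonneg mult_nonpos_nonpos)
  have DD: "DD \<ge> 0"
    unfolding DD_def D_def by (intro sum_nonneg dlog_nonneg)
  \<comment> \<open>By induction the fibres contribute the pairs avoiding \<open>k\<close>; the law
    of the value at \<open>k\<close> contributes the pairs starting at \<open>k\<close>.\<close>
  have step: "ent F {p. p permutes A} \<le>
      (\<Sum>i\<in>A - {k}. \<Sum>j\<in>A - {k}. D i j) / (2 * N) + (\<Sum>j\<in>A. D k j) / (2 * n)"
    if k: "k \<in> A" for k
  proof -
    define B where "B = A - {k}"
    have AB: "A = insert k B" "k \<notin> B" "finite B" "N = card B"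
      using k A Suc(2) by (auto simp: B_def)
    let ?F = "\<lambda>l q. F (transpose k l \<circ> q)"
    let ?G = "\<lambda>l. \<Sum>q | q permutes B. ?F l q"
    have Gpos: "?G l > 0" for l
      using AB by (intro sum_pos pos) (auto simp: finite_permutations intro: permutes_id)
    have "(\<Sum>l\<in>A. ent (?F l) {q. q permutes B}) \<le>
      (\<Sum>l\<in>A. (\<Sum>i\<in>B. \<Sum>j\<in>B. \<Sum>q | q permutes B. dlog (?F l q) (?F l (q \<circ> transpose i j))) / (2 * N))"
      proof (intro sum_mono)
      fix l
      show "ent (?F l) {q. q permutes B} \<le>
          (\<Sum>i\<in>B. \<Sum>j\<in>B. \<Sum>q | q permutes B. dlog (?F l q) (?F l (q \<circ> transpose i j))) / (2 * N)"
        using Suc.hyps(1)[OF AB(4,3), of "?F l"] pos AB(4) by simp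
    qed
    also have "\<dots> = (\<Sum>i\<in>B. \<Sum>j\<in>B. D i j) / (2 * N)"
    proof -
      \<comment> \<open>Right multiplication by \<open>transpose i j\<close> leaves the factor
        \<open>transpose k l\<close> alone, so the sums over fibres add up to
        \<open>D i j\<close>.\<close>
      have "D i j = (\<Sum>l\<in>A. \<Sum>q | q permutes B. dlog (?F l q) (?F l (q \<circ> transpose i j)))" for i j
        unfolding D_def AB(1) by (subst sum_over_permutations_insert[OF AB(3,2)]) (simp add: o_assoc)
      thus ?thesis
        by (simp add: sum.swap[of _ A B] flip: sum_divide_distrib)
    qed
    finally have 1: "(\<Sum>l\<in>A. ent (?F l) {q. q permutes B}) \<le> (\<Sum>i\<in>B. \<Sum>j\<in>B. D i j) / (2 * N)" .
    have "ent ?G A \<le> (\<Sum>l\<in>A. \<Sum>m\<in>A. dlog (?G l) (?G m)) / (2 * card A)"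
      using A k by (intro ent_le_dlog Gpos) auto
    also have "\<dots> \<le> (\<Sum>j\<in>A. D k j) / (2 * n)"
    proof -
      have "(\<Sum>l\<in>A. \<Sum>m\<in>A. dlog (?G l) (?G m)) \<le> (\<Sum>j\<in>A. D k j)"
        unfolding D_def AB(1) by (rule sum_dlog_cosets_le[OF AB(3,2) pos])
      thus ?thesis by (simp add: n_def divide_right_mono)
    qed
    finally have 2: "ent ?G A \<le> (\<Sum>j\<in>A. D k j) / (2 * n)" .
    have "ent F {p. p permutes A} = (\<Sum>l\<in>A. ent (?F l) {q. q permutes B}) + ent ?G A"
      using ent_permutes_insert[OF AB(3,2), of F] pos AB(1) by simp
    with 1 2 show ?thesis by (simp add: B_def)
  qed
  have diff: "(\<Sum>i\<in>A - {k}. \<Sum>j\<in>A - {k}. D i j) = DD - (\<Sum>i\<in>A. D i k) - (\<Sum>j\<in>A. D k j)"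
    if k: "k \<in> A" for k
    using A k by (simp add: DD_def sum_diff1 sum_subtractf D_self)
  have "n * ent F {p. p permutes A} = (\<Sum>k\<in>A. ent F {p. p permutes A})"
    by (simp add: n_def)
  also have "\<dots> \<le> (\<Sum>k\<in>A. (DD - (\<Sum>i\<in>A. D i k) - (\<Sum>j\<in>A. D k j)) / (2 * N) + (\<Sum>j\<in>A. D k j) / (2 * n))"
    using step diff by (intro sum_mono) simp
  \<comment> \<open>An ordered pair of distinct points avoids \<open>k\<close> for all but two
    \<open>k\<close>, and starts at exactly one.\<close>
  also have "\<dots> = (n * DD - DD - DD) / (2 * N) + DD / (2 * n)"
    using sum.swap[of D A A]
    by (simp add: sum.distrib sum_subtractf n_def DD_def flip: sum_divide_distrib)
  also have "\<dots> \<le> DD / 2"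
  \<comment> \<open>For \<open>N = 0\<close> the first quotient is 0 by division by zero, and
    \<open>n = 1\<close>.\<close>
  proof (cases "N = 0")
    case True
    thus ?thesis using n DD by simp
  next
    case False
    hence N: "real N > 0" by simp
    have "(n * DD - DD - DD) / (2 * N) + DD / (2 * n) = DD / 2 * ((real N - 1) / N + 1 / (N + 1))"
    proof -
      have "n * DD - DD - DD = DD * (real N - 1)" by (simp add: n(2) algebra_simps)
      thus ?thesis by (simp add: n(2) distrib_left)
    qed
    \<comment> \<open>The left side is \<open>1 - 1 / (N * (N + 1))\<close>.\<close>
    also have "(real N - 1) / N + 1 / (N + 1) \<le> 1"
    proof -
      have "real N + real N * real N > 0" using N by (simp add: add_pos_pos)
      thus ?thesis using N by (simp add: field_simps)
    qed
    finally show ?thesis using DD by (simp add: mult_left_mono mult_left_le)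
  qed
  finally show ?case
    using n by (simp add: DD_def D_def n_def field_simps)
qed

section \<open>Exponential functions and one-sided differences\<close>

text \<open>Convexity of \<open>exp\<close>, with the larger exponential kept as a factor. At most
  one summand on the right is nonzero, and exchanging \<open>x\<close> and \<open>y\<close>
  exchanges the two.\<close>

lemma dlog_exp_le:
  "dlog (exp x) (exp y) \<le> exp x * (max 0 (x - y))\<^sup>2 + exp y * (max 0 (y - x))\<^sup>2"
proof -
  have *: "(exp x - exp y) * (x - y) \<le> exp x * (x - y)\<^sup>2" if "y \<le> x" for x y :: real
  proof -
    have "exp x - exp y = exp x * (1 - exp (y - x))"
      by (simp add: exp_diff field_simps)
    also have "\<dots> \<le> exp x * (x - y)"
    proof (rule mult_left_mono)
      show "1 - exp (y - x) \<le> x - y" using exp_ge_add_one_self[of "y - x"] by linarith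
    qed simp
    finally have "(exp x - exp y) * (x - y) \<le> exp x * (x - y) * (x - y)"
      using that by (intro mult_right_mono) auto
    thus ?thesis by (simp add: power2_eq_square mult_ac)
  qed
  show ?thesis
    using *[of x y] *[of y x]
    by (cases "y \<le> x") (auto simp: dlog_def max_def algebra_simps)
qed

lemma ent_exp_permutes_le:
  fixes f :: "('b \<Rightarrow> 'b) \<Rightarrow> real" and C :: real
  assumes A: "finite A" "A \<noteq> {}" and s: "s > 0"
    and V: "\<And>p. p permutes A \<Longrightarrow>
      (\<Sum>i\<in>A. \<Sum>j\<in>A. (max 0 (f p - f (p \<circ> transpose i j)))\<^sup>2) \<le> C * card A"
  shows "ent (\<lambda>p. exp (s * f p)) {p. p permutes A} \<le> C * s\<^sup>2 * (\<Sum>p | p permutes A. exp (s * f p))"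
proof -
  let ?S = "{p. p permutes A}" and ?n = "real (card A)"
  define d where "d = (\<lambda>p i j. (max 0 (f p - f (p \<circ> transpose i j)))\<^sup>2)"
  have n: "?n > 0" using A by (simp add: card_gt_0_iff)
  have max_s: "(max 0 (s * a - s * b))\<^sup>2 = s\<^sup>2 * (max 0 (a - b))\<^sup>2" for a b
    using s by (auto simp: max_def algebra_simps power2_eq_square)
  have D: "(\<Sum>p\<in>?S. dlog (exp (s * f p)) (exp (s * f (p \<circ> transpose i j))))
      \<le> 2 * s\<^sup>2 * (\<Sum>p\<in>?S. exp (s * f p) * d p i j)" if "i \<in> A" "j \<in> A" for i j
  proof -
    let ?q = "\<lambda>p. p \<circ> transpose i j"
    have "(\<Sum>p\<in>?S. dlog (exp (s * f p)) (exp (s * f (?q p)))) \<le>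
        (\<Sum>p\<in>?S. exp (s * f p) * (s\<^sup>2 * d p i j)) +
        (\<Sum>p\<in>?S. exp (s * f (?q p)) * (s\<^sup>2 * d (?q p) i j))"
      unfolding sum.distrib[symmetric]
    proof (rule sum_mono)
      fix p :: "'b \<Rightarrow> 'b"
      have "?q (?q p) = p" by (simp add: comp_assoc)
      thus "dlog (exp (s * f p)) (exp (s * f (?q p))) \<le>
          exp (s * f p) * (s\<^sup>2 * d p i j) + exp (s * f (?q p)) * (s\<^sup>2 * d (?q p) i j)"
        using dlog_exp_le[of "s * f p" "s * f (?q p)"] by (simp only: max_s d_def)
    qed
    \<comment> \<open>Reindexing by the bijection \<open>?q\<close> identifies the two sums. The
      resulting factor 2 later cancels against the one in \<open>2 * card A\<close>.\<close>
    also have "(\<Sum>p\<in>?S. exp (s * f (?q p)) * (s\<^sup>2 * d (?q p) i j))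
        = (\<Sum>p\<in>?S. exp (s * f p) * (s\<^sup>2 * d p i j))"
      using sum_permutations_compose_right[OF permutes_swap_id[OF that],
          of "\<lambda>p. exp (s * f p) * (s\<^sup>2 * d p i j)"] by simp
    also have "(\<Sum>p\<in>?S. exp (s * f p) * (s\<^sup>2 * d p i j)) + (\<Sum>p\<in>?S. exp (s * f p) * (s\<^sup>2 * d p i j))
        = 2 * s\<^sup>2 * (\<Sum>p\<in>?S. exp (s * f p) * d p i j)"
      by (simp add: sum_distrib_left mult_ac)
    finally show ?thesis .
  qed
  have "ent (\<lambda>p. exp (s * f p)) ?S \<le>
      (\<Sum>i\<in>A. \<Sum>j\<in>A. \<Sum>p\<in>?S. dlog (exp (s * f p)) (exp (s * f (p \<circ> transpose i j)))) / (2 * card A)"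
    using ent_permutes_le[OF A(1), of "\<lambda>p. exp (s * f p)"] by simp
  also have "\<dots> \<le> (\<Sum>i\<in>A. \<Sum>j\<in>A. 2 * s\<^sup>2 * (\<Sum>p\<in>?S. exp (s * f p) * d p i j)) / (2 * card A)"
    by (intro divide_right_mono sum_mono D) auto
  also have "(\<Sum>i\<in>A. \<Sum>j\<in>A. 2 * s\<^sup>2 * (\<Sum>p\<in>?S. exp (s * f p) * d p i j))
      = 2 * s\<^sup>2 * (\<Sum>p\<in>?S. exp (s * f p) * (\<Sum>i\<in>A. \<Sum>j\<in>A. d p i j))"
    by (simp add: sum_distrib_left sum.swap[of _ A ?S])
  also have "2 * s\<^sup>2 * (\<Sum>p\<in>?S. exp (s * f p) * (\<Sum>i\<in>A. \<Sum>j\<in>A. d p i j)) / (2 * card A)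
      \<le> 2 * s\<^sup>2 * (\<Sum>p\<in>?S. exp (s * f p) * (C * card A)) / (2 * card A)"
    using V by (intro divide_right_mono mult_left_mono sum_mono) (auto simp: d_def)
  also have "\<dots> = C * s\<^sup>2 * (\<Sum>p\<in>?S. exp (s * f p))"
    using n unfolding mult.assoc[symmetric] sum_distrib_right[symmetric] by simp
  finally show ?thesis .
qed

section \<open>From entropy to tail bounds\<close>

text \<open>Herbst's argument: for \<open>L\<close>, the logarithm of the normalised exponential
  sum, the derivative of \<open>L s / s\<close> is the entropy divided by
  \<open>s\<^sup>2 * H s\<close>, hence at most \<open>C\<close>; and \<open>L s / s\<close> tends
  to the mean of \<open>f\<close>, which is 0.\<close>

lemma herbst_mgf_le:
  fixes f :: "'b \<Rightarrow> real"
  assumes S: "finite S" "S \<noteq> {}" and centred: "sum f S = 0"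
    and ent: "\<And>s. s > 0 \<Longrightarrow> ent (\<lambda>p. exp (s * f p)) S \<le> C * s\<^sup>2 * (\<Sum>p\<in>S. exp (s * f p))"
    and s: "s > 0"
  shows "(\<Sum>p\<in>S. exp (s * f p)) \<le> card S * exp (C * s\<^sup>2)"
proof -
  define N where "N = real (card S)"
  have N: "N > 0" using S by (simp add: N_def card_gt_0_iff)
  define H where "H = (\<lambda>s. \<Sum>p\<in>S. exp (s * f p))"
  define H' where "H' = (\<lambda>s. \<Sum>p\<in>S. f p * exp (s * f p))"
  define L where "L = (\<lambda>s. ln (H s / N))"
  have H: "H s > 0" for s unfolding H_def using S by (intro sum_pos) auto
  have dH: "(H has_real_derivative H' s) (at s)" for s
    unfolding H_def H'_def by (auto intro!: derivative_eq_intros sum.cong simp: mult.commute)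
  have dL: "(L has_real_derivative H' s / H s) (at s)" for s
    unfolding L_def using N H[of s]
    by (auto intro!: derivative_eq_intros dH simp: field_simps)
  define h where "h = (\<lambda>s. L s / s - C * s)"
  have dh: "\<exists>y. (h has_real_derivative y) (at r) \<and> y \<le> 0" if r: "r > 0" for r
  proof (intro exI conjI)
    show "(h has_real_derivative (H' r / H r * r - L r) / r\<^sup>2 - C) (at r)"
      unfolding h_def using r by (auto intro!: derivative_eq_intros dL simp: power2_eq_square)
    have "ent (\<lambda>p. exp (r * f p)) S = r * H' r - H r * L r"
      by (simp add: ent_def H_def H'_def L_def N_def sum_distrib_left mult_ac)
    with ent[OF r] have "r * H' r - H r * L r \<le> C * r\<^sup>2 * H r"
      by (simp add: H_def)
    hence "(H' r / H r * r - L r) \<le> C * r\<^sup>2"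
      using H[of r] by (simp add: field_simps)
    thus "(H' r / H r * r - L r) / r\<^sup>2 - C \<le> 0"
      using r by (simp add: field_simps)
  qed
  have mono: "h s \<le> h r" if "0 < r" "r < s" for r
    using that dh by (intro DERIV_nonpos_imp_nonincreasing[of r s h]) auto
  have "H' 0 = 0" "L 0 = 0"
    using N centred by (simp_all add: H'_def L_def H_def N_def)
  \<comment> \<open>As \<open>L 0 = 0\<close>, this is the difference quotient of \<open>L\<close>
    at 0.\<close>
  hence "((\<lambda>r. L r / r) \<longlongrightarrow> 0) (at 0)"
    using dL[of 0] by (simp add: has_field_derivative_iff)
  hence "((\<lambda>r. L r / r) \<longlongrightarrow> 0) (at_right 0)"
    by (rule filterlim_mono) (auto simp: at_le)
  hence "((\<lambda>r. L r / r - C * r) \<longlongrightarrow> 0 - C * 0) (at_right 0)"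
    by (intro tendsto_intros)
  hence lim: "(h \<longlongrightarrow> 0) (at_right 0)"
    by (simp add: h_def)
  have "h s \<le> 0"
    by (rule tendsto_lowerbound[OF lim])
       (use s in \<open>auto simp: eventually_at_right_field intro!: exI[of _ s] mono\<close>)
  hence "L s \<le> C * s\<^sup>2"
    using s by (simp add: h_def field_simps power2_eq_square)
  moreover have "H s / N = exp (L s)"
    using H[of s] N by (simp add: L_def)
  ultimately have "H s / N \<le> exp (C * s\<^sup>2)"
    by simp
  thus ?thesis using N by (simp add: H_def N_def field_simps)
qed

lemma card_upper_tail_le:
  fixes f :: "'b \<Rightarrow> real"
  assumes S: "finite S"
    and mgf: "\<And>s. s > 0 \<Longrightarrow> (\<Sum>p\<in>S. exp (s * f p)) \<le> card S * exp (C * s\<^sup>2)"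
    and C: "C \<ge> 0" and r: "r \<ge> 0" "4 * C * u \<le> r\<^sup>2" and u: "u > 0"
  shows "card {p\<in>S. f p > r} \<le> card S * exp (- u)"
proof (cases "C = 0")
  case True
  have "f p \<le> 0" if p: "p \<in> S" for p
  proof (rule ccontr)
    assume "\<not> f p \<le> 0"
    hence fp: "f p > 0" by simp
    \<comment> \<open>With \<open>C = 0\<close> the bound is uniform in \<open>s\<close>; this
      \<open>s\<close> makes \<open>s * f p\<close> equal to \<open>card S\<close> and contradicts
      \<open>exp N > N\<close>.\<close>
    define s where "s = card S / f p"
    have N: "card S > 0" using S p by (auto simp: card_gt_0_iff)
    hence "s > 0" using fp by (simp add: s_def)
    have "exp (s * f p) \<le> (\<Sum>p\<in>S. exp (s * f p))"
      by (rule member_le_sum) (use S p in auto)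
    also have "\<dots> \<le> card S" using mgf[OF \<open>s > 0\<close>] True by simp
    finally have "exp (real (card S)) \<le> card S" using fp by (simp add: s_def)
    thus False using exp_ge_add_one_self[of "real (card S)"] by simp
  qed
  hence "{p\<in>S. f p > r} = {}" using r by force
  thus ?thesis by (simp del: Collect_empty_eq)
next
  case False
  hence C: "C > 0" using C by simp
  hence "r\<^sup>2 > 0" using r u by (intro less_le_trans[OF _ r(2)]) auto
  hence "r > 0" using r(1) by (cases "r = 0") auto
  \<comment> \<open>The minimiser of the Chernoff exponent
    \<open>C * s\<^sup>2 - s * r\<close>.\<close>
  define s where "s = r / (2 * C)"
  have s: "s > 0" using \<open>r > 0\<close> C by (simp add: s_def)
  have "card {p\<in>S. f p > r} * exp (s * r) = (\<Sum>p\<in>{p\<in>S. f p > r}. exp (s * r))"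
    by simp
  also have "\<dots> \<le> (\<Sum>p\<in>{p\<in>S. f p > r}. exp (s * f p))"
    using s by (intro sum_mono) auto
  also have "\<dots> \<le> (\<Sum>p\<in>S. exp (s * f p))"
    using S by (intro sum_mono2) auto
  also have "\<dots> \<le> card S * exp (C * s\<^sup>2)" by (rule mgf[OF s])
  finally have "card {p\<in>S. f p > r} \<le> card S * exp (C * s\<^sup>2) / exp (s * r)"
    by (simp add: field_simps)
  also have "\<dots> = card S * exp (C * s\<^sup>2 - s * r)" by (simp add: exp_diff)
  also have "C * s\<^sup>2 - s * r = - (r\<^sup>2 / (4 * C))"
    using C by (simp add: s_def power2_eq_square field_simps)
  also have "card S * exp \<dots> \<le> card S * exp (- u)"
    using r(2) C by (intro mult_left_mono) (auto simp: field_simps)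
  finally show ?thesis .
qed

section \<open>Suprema of permuted sums\<close>

text \<open>Only the terms at \<open>i\<close> and \<open>j\<close> change. The product form allows
  either factor to be estimated separately.\<close>

lemma sum_transpose_diff:
  fixes c d :: "'b \<Rightarrow> 'c::comm_ring"
  assumes "finite A" "i \<in> A" "j \<in> A"
  shows "(\<Sum>k\<in>A. c k * d k) - (\<Sum>k\<in>A. c (transpose i j k) * d k) = (c i - c j) * (d i - d j)"
proof (cases "i = j")
  case False
  have "(\<Sum>k\<in>A. c k * d k) - (\<Sum>k\<in>A. c (transpose i j k) * d k)
      = (\<Sum>k\<in>A. (c k - c (transpose i j k)) * d k)"
    by (simp add: sum_subtractf left_diff_distrib)
  also have "\<dots> = (\<Sum>k\<in>{i, j}. (c k - c (transpose i j k)) * d k)"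
    using assms by (intro sum.mono_neutral_right) auto
  also have "\<dots> = (c i - c j) * (d i - d j)"
    using False by (simp add: algebra_simps)
  finally show ?thesis .
qed simp

text \<open>Serves both bounds: the values of \<open>t\<close> after centring, and \<open>w\<close>,
  whose sum is zero.\<close>

lemma sum_sq_pairwise_diff:
  fixes d :: "'b \<Rightarrow> real"
  shows "(\<Sum>i\<in>A. \<Sum>j\<in>A. (d i - d j)\<^sup>2) = 2 * card A * (\<Sum>i\<in>A. (d i)\<^sup>2) - 2 * (sum d A)\<^sup>2"
proof -
  have "(sum d A)\<^sup>2 = (\<Sum>i\<in>A. \<Sum>j\<in>A. d i * d j)"
    by (simp add: power2_eq_square sum_product)
  thus ?thesis
    by (simp add: power2_diff sum.distrib sum_subtractf sum_distrib_left mult.assoc)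
qed

text \<open>Pairwise differences ignore the shift by the mean, which makes the squared sum
  vanish.\<close>

lemma sum_sq_pairwise_diff_mean:
  fixes d :: "'b \<Rightarrow> real"
  assumes "finite A" "A \<noteq> {}"
  shows "(\<Sum>i\<in>A. \<Sum>j\<in>A. (d i - d j)\<^sup>2) = 2 * card A * (\<Sum>i\<in>A. (d i - 1 / card A * sum d A)\<^sup>2)"
proof -
  let ?m = "1 / card A * sum d A"
  have "(\<Sum>i\<in>A. d i - ?m) = 0"
    using assms by (simp add: sum_subtractf)
  thus ?thesis
    using sum_sq_pairwise_diff[of "\<lambda>i. d i - ?m" A] by simp
qed

text \<open>The supremum defining \<open>g_sup\<close> need not be attained, whence the slack \<open>\<epsilon>\<close> and the limit.\<close>

lemma g_sup_pos_variation_le: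
  fixes T :: "('a \<Rightarrow> real) set"
  assumes T: "T \<noteq> {}" and bd: "\<And>t i. t \<in> T \<Longrightarrow> i \<in> {1..n} \<Longrightarrow> \<bar>t (x i)\<bar> \<le> 1"
    and R: "\<And>t. t \<in> T \<Longrightarrow>
      (\<Sum>i=1..n. \<Sum>j=1..n. ((w (p i) - w (p j)) * (t (x i) - t (x j)))\<^sup>2) \<le> R"
  shows "(\<Sum>i=1..n. \<Sum>j=1..n. (max 0 (g_sup n T w x p - g_sup n T w x (p \<circ> transpose i j)))\<^sup>2) \<le> R"
proof -
  let ?g = "g_sup n T w x"
  define S where "S = (\<lambda>q t. \<Sum>i=1..n. w (q i) * t (x i))"
  have bdd: "bdd_above (S q ` T)" for q
  proof (rule bdd_aboveI2)
    fix t assume t: "t \<in> T"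
    show "S q t \<le> (\<Sum>i=1..n. \<bar>w (q i)\<bar>)"
      unfolding S_def
    proof (rule sum_mono)
      fix i assume "i \<in> {1..n}"
      have "w (q i) * t (x i) \<le> \<bar>w (q i)\<bar> * \<bar>t (x i)\<bar>"
        by (simp flip: abs_mult)
      also have "\<dots> \<le> \<bar>w (q i)\<bar>"
        using bd[OF t \<open>i \<in> {1..n}\<close>] by (intro mult_left_le) auto
      finally show "w (q i) * t (x i) \<le> \<bar>w (q i)\<bar>" .
    qed
  qed
  have g: "?g q = (SUP t\<in>T. S q t)" for q by (simp add: g_sup_def S_def)
  define V where "V = (\<lambda>e. \<Sum>i=1..n. \<Sum>j=1..n. (max 0 (?g p - ?g (p \<circ> transpose i j) - e))\<^sup>2)"
  have V: "V e \<le> R" if e: "e > 0" for e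
  proof -
    \<comment> \<open>One near-maximiser at \<open>p\<close> serves all pairs \<open>i\<close>,
      \<open>j\<close>, so the sum is controlled by a single \<open>t\<close>.\<close>
    have "\<exists>t\<in>T. ?g p - e < S p t"
      unfolding g using T bdd e by (subst less_cSUP_iff[symmetric]) auto
    then obtain t where t: "t \<in> T" "?g p - e < S p t" by blast
    have "V e \<le> (\<Sum>i=1..n. \<Sum>j=1..n. ((w (p i) - w (p j)) * (t (x i) - t (x j)))\<^sup>2)"
      unfolding V_def
    proof (intro sum_mono)
      fix i j assume ij: "i \<in> {1..n}" "j \<in> {1..n}"
      have "S (p \<circ> transpose i j) t \<le> ?g (p \<circ> transpose i j)"
        unfolding g by (intro cSUP_upper t bdd)
      hence "?g p - ?g (p \<circ> transpose i j) - e \<le> S p t - S (p \<circ> transpose i j) t"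
        using t by simp
      also have "\<dots> = (w (p i) - w (p j)) * (t (x i) - t (x j))"
        using sum_transpose_diff[of "{1..n}" i j "\<lambda>k. w (p k)" "\<lambda>k. t (x k)"] ij
        by (simp add: S_def)
      finally show "(max 0 (?g p - ?g (p \<circ> transpose i j) - e))\<^sup>2
          \<le> ((w (p i) - w (p j)) * (t (x i) - t (x j)))\<^sup>2"
        by (cases "?g p - ?g (p \<circ> transpose i j) - e \<le> 0") (auto simp: max_def intro: power_mono)
    qed
    also have "\<dots> \<le> R" by (rule R[OF t(1)])
    finally show ?thesis .
  qed
  have "(V \<longlongrightarrow> V 0) (at_right 0)"
    unfolding V_def by (auto intro!: tendsto_eq_intros)
  moreover have "eventually (\<lambda>e. V e \<le> R) (at_right 0)"
    by (auto simp: eventually_at_right_field intro!: exI[of _ 1] V)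
  ultimately have "V 0 \<le> R"
    by (rule tendsto_upperbound) simp
  thus ?thesis by (simp add: V_def)
qed

section \<open>Concentration of the permuted supremum\<close>

theorem theorem2:
  fixes n :: nat and E :: "'a measure" and T :: "('a \<Rightarrow> real) set"
    and a b u :: real and w :: "nat \<Rightarrow> real" and x :: "nat \<Rightarrow> 'a"
  assumes "n \<ge> 1"
    and "T \<noteq> {}"
    and "T \<subseteq> E \<rightarrow>\<^sub>M restrict_space borel {-1..1}"
    and "a < 0" and "0 < b"
    and "w \<in> {1..n} \<rightarrow> {a..b}"
    and "(\<Sum>i=1..n. w i) = 0"
    and "x \<in> {1..n} \<rightarrow> space E"
    and "u > 0"
  shows "measure_pmf.prob (uniform_perm n)
           {\<sigma>. g_sup n T w x \<sigma> - measure_pmf.expectation (uniform_perm n) (g_sup n T w x)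
                \<le> 9 * min ((b - a) * sqrt (v_plus n T x)) (L2_set w {1..n}) * sqrt u}
         \<ge> 1 - exp (- u)"
proof -
  let ?A = "{1..n}" and ?S = "{\<sigma>. \<sigma> permutes {1..n}}" and ?g = "g_sup n T w x"
  define d where "d = (\<lambda>t i. t (x i) - 1 / real n * (\<Sum>j=1..n. t (x j)))"
  define v where "v = v_plus n T x"
  define K where "K = min ((b - a) * sqrt v) (L2_set w ?A)"
  define f where "f = (\<lambda>\<sigma>. ?g \<sigma> - measure_pmf.expectation (uniform_perm n) ?g)"
  have A: "finite ?A" "?A \<noteq> {}" using assms(1) by auto
  have S: "finite ?S" "?S \<noteq> {}"
    by (auto simp: finite_permutations intro: permutes_id)
  have bd: "\<bar>t (x i)\<bar> \<le> 1" if "t \<in> T" "i \<in> ?A" for t i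
  proof -
    have "t \<in> E \<rightarrow>\<^sub>M restrict_space borel {-1..1}" using assms(3) that(1) by blast
    moreover have "x i \<in> space E" using assms(8) that(2) by auto
    ultimately have "t (x i) \<in> space (restrict_space borel {-1..1})" by (rule measurable_space)
    thus ?thesis by (auto simp: space_restrict_space)
  qed
  \<comment> \<open>The crude bound 2 on each deviation only ensures that the supremum in
    \<open>v_plus\<close> is over a bounded set.\<close>
  have v: "(\<Sum>i=1..n. (d t i)\<^sup>2) \<le> v" if "t \<in> T" for t
    unfolding v_def v_plus_def d_def
  proof (rule cSUP_upper[OF that bdd_aboveI2])
    fix t assume t: "t \<in> T"
    show "(\<Sum>i=1..n. (t (x i) - 1 / real n * (\<Sum>j=1..n. t (x j)))\<^sup>2) \<le> (\<Sum>i=1..n. 2\<^sup>2)"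
    proof (rule sum_mono)
      fix i assume i: "i \<in> ?A"
      have "\<bar>\<Sum>j=1..n. t (x j)\<bar> \<le> (\<Sum>j=1..n. 1)"
        by (rule order_trans[OF sum_abs sum_mono]) (rule bd[OF t])
      hence "\<bar>1 / real n * (\<Sum>j=1..n. t (x j))\<bar> \<le> 1"
        using assms(1) by (simp add: abs_mult field_simps)
      with bd[OF t i] have "\<bar>t (x i) - 1 / real n * (\<Sum>j=1..n. t (x j))\<bar> \<le> 2" by linarith
      thus "(t (x i) - 1 / real n * (\<Sum>j=1..n. t (x j)))\<^sup>2 \<le> 2\<^sup>2"
        by (simp only: power2_le_iff_abs_le)
    qed
  qed
  have "v \<ge> 0"
    using assms(2) v by (meson all_not_in_conv order_trans sum_nonneg zero_le_power2)
  hence K: "K \<ge> 0" using assms by (simp add: K_def)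
  have var: "(\<Sum>i\<in>?A. \<Sum>j\<in>?A. (max 0 (f p - f (p \<circ> transpose i j)))\<^sup>2) \<le> 8 * K\<^sup>2 * card ?A"
    if p: "p permutes ?A" for p
  proof -
    have R: "(\<Sum>i=1..n. \<Sum>j=1..n. ((w (p i) - w (p j)) * (t (x i) - t (x j)))\<^sup>2) \<le> 8 * K\<^sup>2 * n"
      (is "?R \<le> _") if t: "t \<in> T" for t
    proof -
      \<comment> \<open>First estimate: the differences of weights are at most \<open>b - a\<close>,
        and the pairwise identity yields the constant 2.\<close>
      have "?R \<le> (\<Sum>i=1..n. \<Sum>j=1..n. (b - a)\<^sup>2 * (t (x i) - t (x j))\<^sup>2)"
        unfolding power_mult_distrib
      proof (intro sum_mono mult_right_mono)
        fix i j assume "i \<in> ?A" "j \<in> ?A"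
        hence "w (p i) \<in> {a..b}" "w (p j) \<in> {a..b}"
          using assms(6) permutes_in_image[OF p] by auto
        hence "\<bar>w (p i) - w (p j)\<bar> \<le> \<bar>b - a\<bar>" by auto
        thus "(w (p i) - w (p j))\<^sup>2 \<le> (b - a)\<^sup>2" by (simp add: abs_le_square_iff)
      qed simp
      also have "\<dots> = (b - a)\<^sup>2 * (\<Sum>i=1..n. \<Sum>j=1..n. (t (x i) - t (x j))\<^sup>2)"
        by (simp add: sum_distrib_left)
      also have "\<dots> = 2 * n * ((b - a)\<^sup>2 * (\<Sum>i=1..n. (d t i)\<^sup>2))"
        using sum_sq_pairwise_diff_mean[OF A, of "\<lambda>i. t (x i)"] by (simp add: d_def)
      also have "\<dots> \<le> 2 * n * ((b - a)\<^sup>2 * v)"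
        by (intro mult_left_mono v t) auto
      finally have 1: "?R \<le> 2 * n * ((b - a) * sqrt v)\<^sup>2"
        using \<open>v \<ge> 0\<close> by (simp add: power_mult_distrib)
      \<comment> \<open>Second estimate: the differences of \<open>t\<close> are at most 2, which
        gives the constant 4 times 2; reindexing by \<open>p\<close> removes the permutation from
        the weights.\<close>
      have "?R \<le> (\<Sum>i=1..n. \<Sum>j=1..n. (w (p i) - w (p j))\<^sup>2 * 2\<^sup>2)"
        unfolding power_mult_distrib
      proof (intro sum_mono mult_left_mono)
        fix i j assume "i \<in> ?A" "j \<in> ?A"
        hence "\<bar>t (x i) - t (x j)\<bar> \<le> \<bar>2\<bar>" using bd[OF t] by (smt (verit))
        thus "(t (x i) - t (x j))\<^sup>2 \<le> 2\<^sup>2" by (simp only: abs_le_square_iff)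
      qed simp
      also have "\<dots> = 4 * (\<Sum>i=1..n. \<Sum>j=1..n. (w (p i) - w (p j))\<^sup>2)"
        by (simp add: sum_distrib_left mult.commute)
      also have "\<dots> = 4 * (\<Sum>i=1..n. \<Sum>j=1..n. (w i - w j)\<^sup>2)"
        using sum.permute[OF p, of "\<lambda>i. \<Sum>j=1..n. (w i - w j)\<^sup>2"]
          sum.permute[OF p, of "\<lambda>j. (w i - w j)\<^sup>2" for i] by (simp add: o_def)
      also have "\<dots> = 8 * n * (L2_set w ?A)\<^sup>2"
        using assms(7) by (simp add: sum_sq_pairwise_diff L2_set_def sum_nonneg)
      finally have 2: "?R \<le> 8 * n * (L2_set w ?A)\<^sup>2" .
      show ?thesis
      proof (cases "(b - a) * sqrt v \<le> L2_set w ?A")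
        case True
        with 1 have "?R \<le> 2 * n * K\<^sup>2" by (simp add: K_def min_def)
        also have "\<dots> \<le> 8 * K\<^sup>2 * n" by simp
        finally show ?thesis .
      next
        case False
        with 2 show ?thesis by (simp add: K_def min_def mult_ac)
      qed
    qed
    have "(\<Sum>i=1..n. \<Sum>j=1..n. (max 0 (?g p - ?g (p \<circ> transpose i j)))\<^sup>2) \<le> 8 * K\<^sup>2 * n"
      using assms(2) bd R by (rule g_sup_pos_variation_le)
    thus ?thesis by (simp add: f_def)
  qed
  have cardS: "real (card ?S) > 0" using S by (simp add: card_gt_0_iff)
  have mean: "measure_pmf.expectation (uniform_perm n) ?g = sum ?g ?S / card ?S"
    unfolding uniform_perm_def by (rule integral_pmf_of_set[OF S(2,1)])
  have prob: "measure_pmf.prob (uniform_perm n) B = card (?S \<inter> B) / card ?S" for B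
    unfolding uniform_perm_def by (rule measure_pmf_of_set[OF S(2,1)])
  have "sum f ?S = 0"
    using cardS by (simp add: f_def sum_subtractf mean)
  hence mgf: "(\<Sum>\<sigma>\<in>?S. exp (s * f \<sigma>)) \<le> card ?S * exp (8 * K\<^sup>2 * s\<^sup>2)" if "s > 0" for s
    using herbst_mgf_le[OF S _ ent_exp_permutes_le[OF A _ var] that] by simp
  define r where "r = 9 * K * sqrt u"
  have "card {\<sigma>\<in>?S. f \<sigma> > r} \<le> card ?S * exp (- u)"
  proof (rule card_upper_tail_le[OF S(1) mgf])
    \<comment> \<open>The tail bound with \<open>C = 8 * K\<^sup>2\<close> needs
      \<open>r\<^sup>2 \<ge> 32 * K\<^sup>2 * u\<close>, and \<open>r\<^sup>2\<close> is
      \<open>81 * K\<^sup>2 * u\<close>.\<close>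
    have "32 * (K\<^sup>2 * u) \<le> 81 * (K\<^sup>2 * u)" using assms(9) by simp
    thus "4 * (8 * K\<^sup>2) * u \<le> r\<^sup>2"
      using assms(9) by (simp add: r_def power_mult_distrib)
  qed (use K assms(9) in \<open>auto simp: r_def\<close>)
  hence "measure_pmf.prob (uniform_perm n) {\<sigma>. f \<sigma> > r} \<le> exp (- u)"
    using cardS by (simp add: prob Int_def field_simps)
  moreover have "measure_pmf.prob (uniform_perm n) {\<sigma>. f \<sigma> \<le> r}
      = 1 - measure_pmf.prob (uniform_perm n) {\<sigma>. f \<sigma> > r}"
    by (subst measure_pmf.prob_compl[symmetric]) (auto intro!: arg_cong[of _ _ "measure_pmf.prob _"])
  ultimately show ?thesis
    by (simp add: f_def r_def K_def v_def)
qed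

end
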